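(* Let $\gamma,\alpha,\lambda>0$ and let $\Xi$ be a privacy parameter (for pDP or aDP). Let $r$ be a lower bound on the query complexity of $\Xi$-privacy property testers with proximity parameter $\alpha$ in the two-database setting. If $\gamma+\frac{\alpha}{\lambda}$ is sufficiently small, then any non-adaptive $(\Xi,\gamma)$-random privacy property tester with proximity parameter $\alpha$ has query complexity \[\Omega\left(\max\left\{r,\frac{\lambda}{\alpha}\right\}\right).\]
   Context: A database is a vector $D\in\mathbb{Z}^{|\Omega|}$ over a data universe $\Omega$; two databases are neighbouring if they differ on a single data point. A randomised algorithm $\mathcal{A}$ is identified with the collection $\{P_D\}$ of its output distributions on $[n]=\{1,\dots,n\}$. In the two-database setting an algorithm $\mathcal{A}=(P_0,P_1)$ accepts only two databases $0,1$, assumed neighbouring. $D_\infty(P,Q)=\sup_E\ln\frac{P(E)}{Q(E)}$ and $D^\delta_\infty(P,Q)=\sup_{E:\,P(E)\ge\delta}\ln\frac{P(E)-\delta}{Q(E)}$. $\mathcal{A}$ is $\epsilon$-pDP ($\Xi=\epsilon$) if $D_\infty(P_D,P_{D'})\le\epsilon$, and $(\epsilon,\delta)$-aDP ($\Xi=(\epsilon,\delta)$) if $D^\delta_\infty(P_D,P_{D'})\le\epsilon$, for all ordered pairs of neighbouring databases $D,D'$. Given a distribution $\mathcal{D}$ on $\Omega$, sample a random neighbouring pair $(D,D')$ by letting $D$ consist of a fixed number of i.i.d. points of $\mathcal{D}$ and $D'=[D_{-1},z]$ be $D$ with its first data point replaced by an independent $z\sim\mathcal{D}$. $\mathcal{A}$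 is $(\Xi,\gamma)$-random private if with probability at least $1-\gamma$ over this random pair, $(P_D,P_{D'})$ is $\Xi$-private as a two-database algorithm. $\mathcal{A}$ is $\alpha$-far from $\Xi$-private if $\min_{\Xi'}\|\Xi'-\Xi\|>\alpha$, minimum over all $\Xi'$ such that $\mathcal{A}$ is $\Xi'$-private ($+\infty$ if none); here $\|\Xi-\Xi'\|=|\epsilon-\epsilon'|$ for pDP, and for aDP $\epsilon$ is kept fixed and $\|\Xi-\Xi'\|=|\delta-\delta'|$. For $(\Xi,\gamma)$-random privacy the same definition is used with the metric $\max\{\|\Xi-\Xi'\|,\lambda|\gamma-\gamma'|\}$, where $\lambda>0$ is a fixed scalar. A property tester with proximity parameter $\alpha$ has black-box access to $\mathcal{A}$ (a query chooses a database $D$ and returns an independent sample of $P_D$); it ACCEPTS with probability at least $2/3$ if $\mathcal{A}$ is private with the given parameters (and the side information, if any, is accurate), and REJECTS with probability at least $2/3$ if $\mathcal{A}$ is $\alpha$-far from private with the given parameters. Query complexity is the number of queries. A tester is non-adaptive if it chooses $m$ pairs of databases and queries the black-box with each database $r'$ times, without choosing its queries adaptively. Testers are required to work for every data universe and data distribution, so lower bounds are worst-case over these.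
   Formalization: The lower bound r is assumed positive: if no two-database algorithm is α-far from private (e.g. n=1, or aDP with α≥1−δ), r=0 is a lower bound, a tester making no queries is correct, and the bound λ/α fails. *)

theory Defs
  imports "HOL-Probability.Probability"
begin

(* A randomised algorithm is the family of its output laws: the type variable 'd is the type of
   databases it accepts.  It outputs elements of [n] on every database of the set X. *)

type_synonym 'd algorithm = "'d \<Rightarrow> nat pmf"

definition algorithms :: "nat \<Rightarrow> 'd set \<Rightarrow> 'd algorithm set" where
  "algorithms n X = {A. \<forall>D\<in>X. set_pmf (A D) \<subseteq> {1..n}}"


(* ln (p / q) with values in the extended reals: ln 0 is -\<infinity>, p / 0 is \<infinity> for p > 0, and 0 / 0
   counts as 0, so that null events never contribute to the suprema below. *)

definition ln_ratio :: "real \<Rightarrow> real \<Rightarrow> ereal" where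
  "ln_ratio p q = (if p \<le> 0 then -\<infinity> else if q \<le> 0 then \<infinity> else ereal (ln (p / q)))"

definition max_divergence :: "'a pmf \<Rightarrow> 'a pmf \<Rightarrow> ereal" where
  "max_divergence P Q = (SUP E. ln_ratio (measure_pmf.prob P E) (measure_pmf.prob Q E))"

definition approx_max_divergence :: "real \<Rightarrow> 'a pmf \<Rightarrow> 'a pmf \<Rightarrow> ereal" where
  "approx_max_divergence \<delta> P Q =
     (SUP E\<in>{E. measure_pmf.prob P E \<ge> \<delta>}.
        ln_ratio (measure_pmf.prob P E - \<delta>) (measure_pmf.prob Q E))"

datatype privacy_param = PDP real | ADP real real

fun valid_param :: "privacy_param \<Rightarrow> bool" where
  "valid_param (PDP \<epsilon>) \<longleftrightarrow> 0 \<le> \<epsilon>"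
| "valid_param (ADP \<epsilon> \<delta>) \<longleftrightarrow> 0 \<le> \<epsilon> \<and> 0 \<le> \<delta> \<and> \<delta> \<le> 1"

fun divergence_bounded :: "privacy_param \<Rightarrow> 'a pmf \<Rightarrow> 'a pmf \<Rightarrow> bool" where
  "divergence_bounded (PDP \<epsilon>) P Q \<longleftrightarrow> max_divergence P Q \<le> ereal \<epsilon>"
| "divergence_bounded (ADP \<epsilon> \<delta>) P Q \<longleftrightarrow> approx_max_divergence \<delta> P Q \<le> ereal \<epsilon>"

(* N is the neighbouring relation, as a set of ordered pairs. *)
definition dp_private :: "('d \<times> 'd) set \<Rightarrow> privacy_param \<Rightarrow> 'd algorithm \<Rightarrow> bool" where
  "dp_private N \<Xi> A \<longleftrightarrow> (\<forall>(D, D')\<in>N. divergence_bounded \<Xi> (A D) (A D'))"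

(* For approximate privacy \<epsilon> is kept fixed; parameters that may not be compared are at distance
   \<infinity>, which makes them irrelevant for the infima below. *)
fun param_dist :: "privacy_param \<Rightarrow> privacy_param \<Rightarrow> ereal" where
  "param_dist (PDP \<epsilon>) (PDP \<epsilon>') = ereal \<bar>\<epsilon> - \<epsilon>'\<bar>"
| "param_dist (ADP \<epsilon> \<delta>) (ADP \<epsilon>' \<delta>') = (if \<epsilon> = \<epsilon>' then ereal \<bar>\<delta> - \<delta>'\<bar> else \<infinity>)"
| "param_dist _ _ = \<infinity>"

(* The infimum of the empty set is \<infinity>. *)
definition far_from_private ::
  "('d \<times> 'd) set \<Rightarrow> privacy_param \<Rightarrow> real \<Rightarrow> 'd algorithm \<Rightarrow> bool" where
  "far_from_private N \<Xi> \<alpha> A \<longleftrightarrow>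
     (INF \<Xi>'\<in>{\<Xi>'. valid_param \<Xi>' \<and> dp_private N \<Xi>' A}. param_dist \<Xi> \<Xi>') > ereal \<alpha>"


(* Correctness of a tester whose verdict on the black box A has the law run A (True is ACCEPT). *)
definition tests_property ::
  "'d algorithm set \<Rightarrow> ('d algorithm \<Rightarrow> bool) \<Rightarrow> ('d algorithm \<Rightarrow> bool) \<Rightarrow>
   ('d algorithm \<Rightarrow> bool pmf) \<Rightarrow> bool" where
  "tests_property \<A> priv far run \<longleftrightarrow>
     (\<forall>A\<in>\<A>. (priv A \<longrightarrow> pmf (run A) True \<ge> 2 / 3) \<and> (far A \<longrightarrow> pmf (run A) False \<ge> 2 / 3))"

(* Arbitrary, possibly adaptive and randomised testers.  Each query and the final verdict are drawn
   from a law that depends on the transcript of all earlier queries and answers.  Using fewer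
   queries than the budget num_queries amounts to ignoring the remaining answers. *)
record 'd tester =
  num_queries :: nat
  next_query :: "('d \<times> nat) list \<Rightarrow> 'd pmf"
  verdict :: "('d \<times> nat) list \<Rightarrow> bool pmf"

primrec transcript :: "'d tester \<Rightarrow> 'd algorithm \<Rightarrow> nat \<Rightarrow> ('d \<times> nat) list pmf" where
  "transcript T A 0 = return_pmf []"
| "transcript T A (Suc q) =
     do {h \<leftarrow> transcript T A q; D \<leftarrow> next_query T h; x \<leftarrow> A D; return_pmf (h @ [(D, x)])}"

definition run_tester :: "'d tester \<Rightarrow> 'd algorithm \<Rightarrow> bool pmf" where
  "run_tester T A = bind_pmf (transcript T A (num_queries T)) (verdict T)"

(* Two-database setting: False is database 0 and True is database 1. *)
definition two_nbrs :: "(bool \<times> bool) set" where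
  "two_nbrs = {(False, True), (True, False)}"

definition two_database :: "nat pmf \<Rightarrow> nat pmf \<Rightarrow> bool algorithm" where
  "two_database P\<^sub>0 P\<^sub>1 = (\<lambda>b. if b then P\<^sub>1 else P\<^sub>0)"

definition two_database_tester ::
  "nat \<Rightarrow> privacy_param \<Rightarrow> real \<Rightarrow> bool tester \<Rightarrow> bool" where
  "two_database_tester n \<Xi> \<alpha> T \<longleftrightarrow>
     tests_property (algorithms n UNIV) (dp_private two_nbrs \<Xi>) (far_from_private two_nbrs \<Xi> \<alpha>)
       (run_tester T)"

definition two_database_lower_bound ::
  "nat \<Rightarrow> privacy_param \<Rightarrow> real \<Rightarrow> real \<Rightarrow> bool" where
  "two_database_lower_bound n \<Xi> \<alpha> r \<longleftrightarrow>
     (\<forall>T. two_database_tester n \<Xi> \<alpha> T \<longrightarrow> r \<le> real (num_queries T))"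


(* A data universe is a nonempty set of natural numbers (a countable universe, up to renaming its
   points); a database is an integer histogram over it. *)

type_synonym database = "nat \<Rightarrow> int"

definition databases :: "nat set \<Rightarrow> database set" where
  "databases \<Omega> = {D. \<forall>a. a \<notin> \<Omega> \<longrightarrow> D a = 0}"

definition data_models :: "(nat set \<times> nat pmf) set" where
  "data_models = {(\<Omega>, \<D>). \<Omega> \<noteq> {} \<and> set_pmf \<D> \<subseteq> \<Omega>}"

definition histogram :: "nat list \<Rightarrow> database" where
  "histogram xs = (\<lambda>a. int (count_list xs a))"

(* k is the number of data points, k \<ge> 1. *)
definition random_neighbours :: "nat \<Rightarrow> nat pmf \<Rightarrow> (database \<times> database) pmf" where
  "random_neighbours k \<D> =
     do {xs \<leftarrow> replicate_pmf k \<D>; z \<leftarrow> \<D>; return_pmf (histogram xs, histogram (z # tl xs))}"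

definition random_private ::
  "nat \<Rightarrow> nat pmf \<Rightarrow> privacy_param \<Rightarrow> real \<Rightarrow> database algorithm \<Rightarrow> bool" where
  "random_private k \<D> \<Xi> \<gamma> A \<longleftrightarrow>
     measure_pmf.prob (random_neighbours k \<D>)
       {(D, D'). dp_private two_nbrs \<Xi> (two_database (A D) (A D'))} \<ge> 1 - \<gamma>"

definition far_from_random_private ::
  "nat \<Rightarrow> nat pmf \<Rightarrow> real \<Rightarrow> privacy_param \<Rightarrow> real \<Rightarrow> real \<Rightarrow> database algorithm \<Rightarrow> bool" where
  "far_from_random_private k \<D> lam \<Xi> \<gamma> \<alpha> A \<longleftrightarrow>
     (INF (\<Xi>', \<gamma>')\<in>{(\<Xi>', \<gamma>'). valid_param \<Xi>' \<and> 0 \<le> \<gamma>' \<and> \<gamma>' \<le> 1 \<and> random_private k \<D> \<Xi>' \<gamma>' A}.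
        max (param_dist \<Xi> \<Xi>') (ereal (lam * \<bar>\<gamma> - \<gamma>'\<bar>))) > ereal \<alpha>"

(* Non-adaptive testers: num_pairs pairs of databases are drawn at once, independently of all
   answers, each of the two databases in each pair is queried reps times, and the verdict depends on
   the pairs and on the answers, which are listed pair by pair. *)
record na_tester =
  num_pairs :: nat
  reps :: nat
  choose_pairs :: "(database \<times> database) list pmf"
  na_verdict :: "(database \<times> database) list \<Rightarrow> (nat list \<times> nat list) list \<Rightarrow> bool pmf"

definition well_formed :: "nat set \<Rightarrow> na_tester \<Rightarrow> bool" where
  "well_formed \<Omega> T \<longleftrightarrow>
     (\<forall>ps\<in>set_pmf (choose_pairs T). length ps = num_pairs T \<and> set ps \<subseteq> databases \<Omega> \<times> databases \<Omega>)"

definition na_queries :: "na_tester \<Rightarrow> nat" where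
  "na_queries T = 2 * num_pairs T * reps T"

fun sample_pairs ::
  "nat \<Rightarrow> database algorithm \<Rightarrow> (database \<times> database) list \<Rightarrow> (nat list \<times> nat list) list pmf" where
  "sample_pairs r' A [] = return_pmf []"
| "sample_pairs r' A ((D, D') # ps) =
     do {xs \<leftarrow> replicate_pmf r' (A D);
         ys \<leftarrow> replicate_pmf r' (A D');
         rest \<leftarrow> sample_pairs r' A ps;
         return_pmf ((xs, ys) # rest)}"

definition run_na_tester :: "na_tester \<Rightarrow> database algorithm \<Rightarrow> bool pmf" where
  "run_na_tester T A =
     do {ps \<leftarrow> choose_pairs T; ans \<leftarrow> sample_pairs (reps T) A ps; na_verdict T ps ans}"

(* A tester has to work for every data universe and data distribution; what it does may depend on
   both, so it is a family indexed by them.  Its query complexity is the worst case over them. *)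

type_synonym na_tester_family = "nat set \<times> nat pmf \<Rightarrow> na_tester"

definition random_privacy_tester ::
  "nat \<Rightarrow> nat \<Rightarrow> real \<Rightarrow> privacy_param \<Rightarrow> real \<Rightarrow> real \<Rightarrow> na_tester_family \<Rightarrow> bool" where
  "random_privacy_tester n k lam \<Xi> \<gamma> \<alpha> T \<longleftrightarrow>
     (\<forall>(\<Omega>, \<D>)\<in>data_models.
        well_formed \<Omega> (T (\<Omega>, \<D>)) \<and>
        tests_property (algorithms n (databases \<Omega>))
          (random_private k \<D> \<Xi> \<gamma>) (far_from_random_private k \<D> lam \<Xi> \<gamma> \<alpha>)
          (run_na_tester (T (\<Omega>, \<D>))))"

definition query_complexity :: "na_tester_family \<Rightarrow> ereal" where
  "query_complexity T = (SUP M\<in>data_models. ereal (real (na_queries (T M))))"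

end

theory Submission
  imports Defs
begin

text \<open>Write $\eta = \alpha / \lambda$. A colouring $c$ of the databases turns a two-database algorithm $B$
  into the algorithm $B \circ c$, whose random pairs behave like $B$ when they are bichromatic and are
  trivially private otherwise. So $B \circ c$ is random private if $B$ is private or the bichromatic
  pairs have probability at most $\gamma$, and it is far from random private if $B$ is far from private
  and they have probability more than $\gamma + \eta$.

  Bound $r$: if the first data point contributes a fair bit to a parity that is used as the colour,
  half of the pairs are bichromatic, and testing $B \circ c$ amounts to testing $B$.

  Bound $1/\eta$: let every data point carry a bit, biased so that the parity colouring has bichromatic
  pairs with probability exactly $\gamma$, and a residue modulo $M \approx 1/\eta$. Flipping the colour
  of the databases whose residues add up to $i$ raises this probability above $\gamma + \eta$. Each
  database is recoloured for only one $i$, so a non-adaptive tester that notices the change for every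
  $i$ needs about $M/3$ queries. The algorithm $B$ exists because $r > 0$ excludes the tester that
  always accepts without any query.\<close>

section \<open>Privacy and farness of coloured algorithms\<close>

lemma divergence_bounded_refl:
  assumes "valid_param \<Xi>"
  shows "divergence_bounded \<Xi> P P"
proof (cases \<Xi>)
  case (PDP \<epsilon>)
  have "ln_ratio p p \<le> ereal \<epsilon>" for p
    using assms PDP by (simp add: ln_ratio_def)
  then show ?thesis
    using PDP by (simp add: max_divergence_def SUP_le_iff)
next
  case (ADP \<epsilon> \<delta>)
  have "ln_ratio (p - \<delta>) p \<le> ereal \<epsilon>" if "0 \<le> p" for p
  proof (cases "p - \<delta> \<le> 0")
    case False
    then have "0 < p" "0 \<le> \<epsilon>" "ln ((p - \<delta>) / p) \<le> 0"
      using assms ADP that by auto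
    then have "ln ((p - \<delta>) / p) \<le> \<epsilon>" by linarith
    then show ?thesis
      using False \<open>0 < p\<close> by (simp add: ln_ratio_def del: ln_divide_pos)
  qed (simp add: ln_ratio_def)
  then show ?thesis
    using ADP by (simp add: approx_max_divergence_def SUP_le_iff)
qed

lemma dp_private_two_nbrs:
  "dp_private two_nbrs \<Xi> B \<longleftrightarrow>
     divergence_bounded \<Xi> (B False) (B True) \<and> divergence_bounded \<Xi> (B True) (B False)"
  by (auto simp: dp_private_def two_nbrs_def)

lemma dp_private_two_database_refl:
  "valid_param \<Xi> \<Longrightarrow> dp_private two_nbrs \<Xi> (two_database P P)"
  by (simp add: dp_private_two_nbrs two_database_def divergence_bounded_refl)

text \<open>The relation \<open>two_nbrs\<close> contains both orders of the two databases, so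
  exchanging them changes nothing.\<close>

lemma dp_private_two_database_neq:
  "a \<noteq> b \<Longrightarrow> dp_private two_nbrs \<Xi> (two_database (B a) (B b)) \<longleftrightarrow> dp_private two_nbrs \<Xi> B"
  by (cases a; cases b) (auto simp: dp_private_two_nbrs two_database_def)

definition violation :: "nat \<Rightarrow> nat pmf \<Rightarrow> (database \<Rightarrow> bool) \<Rightarrow> real" where
  "violation k \<D> c = measure_pmf.prob (random_neighbours k \<D>) {(D, D'). c D \<noteq> c D'}"

lemma prob_same_colour:
  "measure_pmf.prob (random_neighbours k \<D>) {(D, D'). c D = c D'} = 1 - violation k \<D> c"
proof -
  have "{(D, D'). c D = c D'} = - {(D, D'). c D \<noteq> c D'}" by auto
  then show ?thesis
    using measure_pmf.prob_compl[of "{(D, D'). c D \<noteq> c D'}" "random_neighbours k \<D>"]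
    by (simp add: violation_def Compl_eq_Diff_UNIV)
qed

lemma random_private_colouring:
  assumes "valid_param \<Xi>" "dp_private two_nbrs \<Xi> B \<or> violation k \<D> c \<le> \<gamma>" "0 \<le> \<gamma>"
  shows "random_private k \<D> \<Xi> \<gamma> (\<lambda>D. B (c D))"
proof -
  let ?priv = "{(D, D'). dp_private two_nbrs \<Xi> (two_database (B (c D)) (B (c D')))}"
  consider "dp_private two_nbrs \<Xi> B" | "violation k \<D> c \<le> \<gamma>" using assms(2) by blast
  then have "1 - \<gamma> \<le> measure_pmf.prob (random_neighbours k \<D>) ?priv"
  proof cases
    case 1
    then have "dp_private two_nbrs \<Xi> (two_database (B (c D)) (B (c D')))" for D D'
      using assms(1) dp_private_two_database_refl dp_private_two_database_neq
      by (cases "c D = c D'") auto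
    then have "?priv = UNIV" by auto
    then show ?thesis using assms(3) by simp
  next
    case 2
    have "{(D, D'). c D = c D'} \<subseteq> ?priv"
      using assms(1) by (auto simp: dp_private_two_database_refl)
    then have "1 - violation k \<D> c \<le> measure_pmf.prob (random_neighbours k \<D>) ?priv"
      unfolding prob_same_colour[symmetric] by (intro measure_pmf.finite_measure_mono) auto
    then show ?thesis using 2 by simp
  qed
  then show ?thesis by (simp add: random_private_def)
qed

text \<open>Let v be the bichromatic probability. A competitor with \<gamma>' < v must make some
  bichromatic pair private, because the monochromatic pairs only have probability 1 - v; hence B
  itself is \<Xi>'-private and the first component of the metric is large. A competitor with
  \<gamma>' \<ge> v pays in the second component.\<close>

lemma far_from_random_private_colouring:
  assumes far: "far_from_private two_nbrs \<Xi> \<alpha> B"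
    and v: "\<gamma> + \<alpha> / lam < violation k \<D> c" and "0 < lam"
  shows "far_from_random_private k \<D> lam \<Xi> \<gamma> \<alpha> (\<lambda>D. B (c D))"
proof -
  let ?v = "violation k \<D> c"
  define I where "I = (INF \<Xi>'\<in>{\<Xi>'. valid_param \<Xi>' \<and> dp_private two_nbrs \<Xi>' B}. param_dist \<Xi> \<Xi>')"
  have gap: "\<alpha> < lam * (?v - \<gamma>)"
    using v \<open>0 < lam\<close> by (simp add: field_simps)
  \<comment> \<open>An infimum of values above \<alpha> may equal \<alpha>, so one bound strictly
    above \<alpha> is shown for all competitors at once.\<close>
  have "min I (ereal (lam * (?v - \<gamma>))) \<le> max (param_dist \<Xi> \<Xi>') (ereal (lam * \<bar>\<gamma> - \<gamma>'\<bar>))"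
    if "valid_param \<Xi>'" and rp: "random_private k \<D> \<Xi>' \<gamma>' (\<lambda>D. B (c D))" for \<Xi>' \<gamma>'
  proof (cases "\<gamma>' < ?v")
    case True
    have "dp_private two_nbrs \<Xi>' B"
    proof (rule ccontr)
      assume np: "\<not> dp_private two_nbrs \<Xi>' B"
      let ?priv = "{(D, D'). dp_private two_nbrs \<Xi>' (two_database (B (c D)) (B (c D')))}"
      have "?priv \<subseteq> {(D, D'). c D = c D'}"
        using np dp_private_two_database_neq by blast
      then have "measure_pmf.prob (random_neighbours k \<D>) ?priv \<le> 1 - ?v"
        unfolding prob_same_colour[symmetric] by (intro measure_pmf.finite_measure_mono) auto
      then show False using rp True by (simp add: random_private_def)
    qed
    then have "I \<le> param_dist \<Xi> \<Xi>'"
      using that unfolding I_def by (intro INF_lower) auto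
    then show ?thesis by (meson max.coboundedI1 min.coboundedI1)
  next
    case False
    then have "lam * (?v - \<gamma>) \<le> lam * \<bar>\<gamma> - \<gamma>'\<bar>"
      using \<open>0 < lam\<close> by (intro mult_left_mono) auto
    then show ?thesis by (meson ereal_less_eq(3) max.coboundedI2 min.coboundedI2)
  qed
  then have "min I (ereal (lam * (?v - \<gamma>))) \<le>
    (INF (\<Xi>', \<gamma>')\<in>{(\<Xi>', \<gamma>'). valid_param \<Xi>' \<and> 0 \<le> \<gamma>' \<and> \<gamma>' \<le> 1 \<and>
        random_private k \<D> \<Xi>' \<gamma>' (\<lambda>D. B (c D))}.
        max (param_dist \<Xi> \<Xi>') (ereal (lam * \<bar>\<gamma> - \<gamma>'\<bar>)))"
    by (intro INF_greatest) auto
  moreover have "ereal \<alpha> < min I (ereal (lam * (?v - \<gamma>)))"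
    using far gap by (auto simp: I_def far_from_private_def)
  ultimately show ?thesis
    unfolding far_from_random_private_def by (rule less_le_trans[rotated])
qed

section \<open>Bichromatic probability of the parity-and-residue colouring\<close>

text \<open>For p and q in the unit interval, this is the probability that two independent bits with
  these biases differ.\<close>

definition xor_prob :: "real \<Rightarrow> real \<Rightarrow> real" where
  "xor_prob p q = p * (1 - q) + q * (1 - p)"

lemma xor_prob_bounds:
  assumes "0 \<le> p" "p \<le> 1" "0 \<le> q" "q \<le> 1"
  shows "0 \<le> xor_prob p q" "xor_prob p q \<le> 1"
proof -
  show "0 \<le> xor_prob p q" using assms by (simp add: xor_prob_def)
  have "p * (1 - q) + q * (1 - p) \<le> 1 * (1 - q) + q * 1"
    using assms by (intro add_mono mult_mono) auto
  then show "xor_prob p q \<le> 1" by (simp add: xor_prob_def)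
qed

lemma bool_pmf_eqI: "pmf P True = pmf Q True \<Longrightarrow> P = Q" for P Q :: "bool pmf"
  by (rule pmf_eqI) (metis (full_types) pmf_False_conv_True)

lemma xor_bernoulli:
  assumes "0 \<le> p" "p \<le> 1" "0 \<le> q" "q \<le> 1"
  shows "map_pmf (\<lambda>(a, b). a \<noteq> b) (pair_pmf (bernoulli_pmf p) (bernoulli_pmf q)) =
    bernoulli_pmf (xor_prob p q)"
proof (rule bool_pmf_eqI)
  let ?R = "pair_pmf (bernoulli_pmf p) (bernoulli_pmf q)"
  have "pmf (map_pmf (\<lambda>(a, b). a \<noteq> b) ?R) True = measure_pmf.prob ?R {(True, False), (False, True)}"
    unfolding pmf_map by (rule arg_cong[where f = "measure_pmf.prob ?R"]) auto
  also have "\<dots> = xor_prob p q"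
    using assms by (subst measure_measure_pmf_finite) (auto simp: pmf_pair xor_prob_def)
  finally show "pmf (map_pmf (\<lambda>(a, b). a \<noteq> b) ?R) True = pmf (bernoulli_pmf (xor_prob p q)) True"
    using assms xor_prob_bounds by simp
qed

text \<open>The point $2a + s$ carries an independent bit $s$ and a uniform residue $a$ modulo $M$.\<close>

definition point_dist :: "nat \<Rightarrow> real \<Rightarrow> nat pmf" where
  "point_dist M p = map_pmf (\<lambda>(s, a). 2 * a + of_bool s)
     (pair_pmf (bernoulli_pmf p) (pmf_of_set {..<M}))"

text \<open>Colours have to be functions of the histogram. This sum is linear in it, so every data
  point below N contributes its own weight.\<close>

definition weighted_sum :: "nat \<Rightarrow> (nat \<Rightarrow> int) \<Rightarrow> database \<Rightarrow> int" where
  "weighted_sum N w D = (\<Sum>y<N. D y * w y)"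

text \<open>A point 2a + s has the parity of its bit s, so the first sum may use the points
  themselves as weights. S is the set of residue sums at which the parity colour is flipped: the
  empty set gives the plain parity, a singleton the hidden modification.\<close>

definition colour :: "nat \<Rightarrow> int set \<Rightarrow> database \<Rightarrow> bool" where
  "colour M S D \<longleftrightarrow> odd (weighted_sum (2 * M) int D) \<noteq>
     (weighted_sum (2 * M) (\<lambda>x. int (x div 2)) D mod int M \<in> S)"

lemma weighted_sum_histogram_Cons:
  assumes "x < N"
  shows "weighted_sum N w (histogram (x # xs)) = w x + weighted_sum N w (histogram xs)"
proof -
  have "weighted_sum N w (histogram (x # xs)) =
    (\<Sum>y<N. (if y = x then w y else 0) + int (count_list xs y) * w y)"
    unfolding weighted_sum_def histogram_def
    by (intro sum.cong) (auto simp: algebra_simps)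
  then show ?thesis
    using assms by (simp add: sum.distrib weighted_sum_def histogram_def)
qed

lemma set_point_dist:
  assumes "0 < M"
  shows "set_pmf (point_dist M p) \<subseteq> {..<2 * M}"
proof -
  have unif: "set_pmf (pmf_of_set {..<M}) = {..<M}"
    using assms by (intro set_pmf_of_set) (simp_all add: lessThan_empty_iff)
  have "2 * a + of_bool s < 2 * M" if "a < M" for a s
    using that by (cases s) simp_all
  then show ?thesis
    unfolding point_dist_def set_map_pmf set_pair_pmf unif by clarsimp
qed

text \<open>Translation by t permutes the residues modulo M, so the uniform law is preserved and the
  probability of hitting S does not depend on t.\<close>

lemma shifted_residue_bernoulli:
  assumes "0 < M" "S \<subseteq> {0..<int M}"
  shows "map_pmf (\<lambda>a. (int a + t) mod int M \<in> S) (pmf_of_set {..<M}) =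
    bernoulli_pmf (card S / M)"
proof -
  have inj: "inj_on (\<lambda>a. (int a + t) mod int M) {..<M}"
  proof (rule inj_onI)
    fix a b assume "a \<in> {..<M}" "b \<in> {..<M}" "(int a + t) mod int M = (int b + t) mod int M"
    then have less: "a < M" "b < M" and "int M dvd (int a + t) - (int b + t)"
      by (simp_all only: mod_eq_dvd_iff lessThan_iff)
    then have "int a mod int M = int b mod int M"
      by (simp only: mod_eq_dvd_iff add_diff_cancel_right)
    with less show "a = b" by simp
  qed
  have "(\<lambda>a. (int a + t) mod int M) ` {..<M} = {0..<int M}"
    using assms inj by (intro card_subset_eq) (auto simp: card_image)
  with inj have unif: "map_pmf (\<lambda>a. (int a + t) mod int M) (pmf_of_set {..<M}) =
    pmf_of_set {0..<int M}"
    using assms by (subst map_pmf_of_set_inj) auto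
  have "map_pmf (\<lambda>a. (int a + t) mod int M \<in> S) (pmf_of_set {..<M}) =
    map_pmf (\<lambda>r. r \<in> S) (pmf_of_set {0..<int M})"
    unfolding unif[symmetric] by (simp add: map_pmf_comp)
  also have "\<dots> = bernoulli_pmf (card S / M)"
  proof (rule bool_pmf_eqI)
    have "card S \<le> card {0..<int M}"
      using assms by (intro card_mono) auto
    moreover have "(\<lambda>r. r \<in> S) -` {True} = S" by auto
    moreover have "{0..<int M} \<inter> S = S" using assms by auto
    ultimately show "pmf (map_pmf (\<lambda>r. r \<in> S) (pmf_of_set {0..<int M})) True =
      pmf (bernoulli_pmf (card S / M)) True"
      using assms by (simp add: pmf_map measure_pmf_of_set)
  qed
  finally show ?thesis .
qed

text \<open>Drawing the common tail first leaves two independent first points with the same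
  law.\<close>

lemma random_neighbours_Suc:
  "random_neighbours (Suc k) \<D> =
     do {xs \<leftarrow> replicate_pmf k \<D>;
         map_pmf (\<lambda>(x, z). (histogram (x # xs), histogram (z # xs))) (pair_pmf \<D> \<D>)}"
proof -
  have "random_neighbours (Suc k) \<D> =
    do {x \<leftarrow> \<D>; xs \<leftarrow> replicate_pmf k \<D>; z \<leftarrow> \<D>;
        return_pmf (histogram (x # xs), histogram (z # xs))}"
    by (simp add: random_neighbours_def bind_assoc_pmf bind_return_pmf)
  also have "\<dots> = do {xs \<leftarrow> replicate_pmf k \<D>; x \<leftarrow> \<D>; z \<leftarrow> \<D>;
        return_pmf (histogram (x # xs), histogram (z # xs))}"
    by (rule bind_commute_pmf)
  finally show ?thesis
    by (simp add: pair_pmf_def map_bind_pmf map_pmf_def bind_assoc_pmf bind_return_pmf)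
qed

text \<open>Fix the common tail. The parity of its bits enters both colours and cancels in the
  comparison, and its residue sum t merely shifts the residue of the first point. What remains are
  two independent bits of bias q, whatever t is.\<close>

lemma violation_colour:
  assumes "0 < M" "S \<subseteq> {0..<int M}" "0 \<le> p" "p \<le> 1" "1 \<le> k"
  defines "q \<equiv> xor_prob p (card S / M)"
  shows "violation k (point_dist M p) (colour M S) = xor_prob q q"
proof -
  obtain k' where k: "k = Suc k'" using \<open>1 \<le> k\<close> by (cases k) auto
  let ?\<D> = "point_dist M p"
  have "card S \<le> card {0..<int M}"
    using assms by (intro card_mono) auto
  then have bounds: "0 \<le> card S / M" "card S / M \<le> 1" using assms by auto
  have q: "0 \<le> q" "q \<le> 1"
    using xor_prob_bounds[OF assms(3,4) bounds] by (auto simp: q_def)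
  \<comment> \<open>This is the colour of a database with first point x and tail residue sum t, up
    to the parity of the tail.\<close>
  define u :: "int \<Rightarrow> nat \<Rightarrow> bool"
    where "u t x \<longleftrightarrow> odd x \<noteq> ((int (x div 2) + t) mod int M \<in> S)" for t x
  have digits: "odd (2 * a + of_bool s) = s" "(2 * a + of_bool s) div 2 = a" for a :: nat and s
    by (cases s; simp)+
  have u: "map_pmf (u t) ?\<D> = bernoulli_pmf q" for t
  proof -
    have "map_pmf (u t) ?\<D> = map_pmf (\<lambda>(a, b). a \<noteq> b) (pair_pmf (map_pmf id (bernoulli_pmf p))
       (map_pmf (\<lambda>a. (int a + t) mod int M \<in> S) (pmf_of_set {..<M})))"
      unfolding point_dist_def pair_map_pmf1 pair_map_pmf2 map_pmf_comp
      by (intro map_pmf_cong refl) (simp add: u_def digits split: prod.splits)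
    also have "\<dots> = bernoulli_pmf q"
      using xor_bernoulli[OF assms(3,4) bounds]
      by (simp add: shifted_residue_bernoulli[OF assms(1,2)] q_def)
    finally show ?thesis .
  qed
  have "map_pmf (\<lambda>(D, D'). colour M S D \<noteq> colour M S D') (random_neighbours k ?\<D>) =
    do {xs \<leftarrow> replicate_pmf k' ?\<D>; bernoulli_pmf (xor_prob q q)}"
    unfolding k random_neighbours_Suc map_bind_pmf
  proof (intro bind_pmf_cong refl)
    fix xs
    define t where "t = weighted_sum (2 * M) (\<lambda>x. int (x div 2)) (histogram xs)"
    have "map_pmf (\<lambda>(D, D'). colour M S D \<noteq> colour M S D')
        (map_pmf (\<lambda>(x, z). (histogram (x # xs), histogram (z # xs))) (pair_pmf ?\<D> ?\<D>)) =
      map_pmf (\<lambda>(x, z). colour M S (histogram (x # xs)) \<noteq> colour M S (histogram (z # xs)))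
        (pair_pmf ?\<D> ?\<D>)"
      by (simp add: map_pmf_comp case_prod_unfold)
    also have "\<dots> = map_pmf (\<lambda>(x, z). u t x \<noteq> u t z) (pair_pmf ?\<D> ?\<D>)"
    proof (rule map_pmf_cong[OF refl])
      fix y assume "y \<in> set_pmf (pair_pmf ?\<D> ?\<D>)"
      moreover obtain x z where "y = (x, z)" by (cases y)
      ultimately have "y = (x, z)" "x < 2 * M" "z < 2 * M"
        using set_point_dist[OF assms(1), of p] by auto
      then show "(case y of (x, z) \<Rightarrow>
          colour M S (histogram (x # xs)) \<noteq> colour M S (histogram (z # xs))) =
        (case y of (x, z) \<Rightarrow> u t x \<noteq> u t z)"
        by (auto simp: colour_def weighted_sum_histogram_Cons u_def t_def)
    qed
    also have "\<dots> = map_pmf (\<lambda>(a, b). a \<noteq> b) (pair_pmf (map_pmf (u t) ?\<D>) (map_pmf (u t) ?\<D>))"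
      unfolding pair_map_pmf1 pair_map_pmf2 map_pmf_comp by (simp add: case_prod_unfold)
    also have "\<dots> = bernoulli_pmf (xor_prob q q)"
      unfolding u using q by (intro xor_bernoulli)
    finally show "map_pmf (\<lambda>(D, D'). colour M S D \<noteq> colour M S D')
        (map_pmf (\<lambda>(x, z). (histogram (x # xs), histogram (z # xs))) (pair_pmf ?\<D> ?\<D>)) =
      bernoulli_pmf (xor_prob q q)" .
  qed
  then have "pmf (map_pmf (\<lambda>(D, D'). colour M S D \<noteq> colour M S D') (random_neighbours k ?\<D>)) True =
    xor_prob q q"
    using q xor_prob_bounds[OF q q] by simp
  moreover have "(\<lambda>(D, D'). colour M S D \<noteq> colour M S D') -` {True} =
    {(D, D'). colour M S D \<noteq> colour M S D'}" by auto
  ultimately show ?thesis by (simp add: violation_def pmf_map)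
qed

section \<open>Simulation by a two-database tester\<close>

primrec sample_list :: "('d \<Rightarrow> 'a pmf) \<Rightarrow> 'd list \<Rightarrow> 'a list pmf" where
  "sample_list A [] = return_pmf []"
| "sample_list A (D # Ds) = do {x \<leftarrow> A D; xs \<leftarrow> sample_list A Ds; return_pmf (x # xs)}"

lemma sample_list_append:
  "sample_list A (Ds @ Es) = do {xs \<leftarrow> sample_list A Ds; ys \<leftarrow> sample_list A Es; return_pmf (xs @ ys)}"
  by (induction Ds) (simp_all add: bind_assoc_pmf bind_return_pmf bind_return_pmf')

lemma sample_list_replicate: "sample_list A (replicate r D) = replicate_pmf r (A D)"
  by (induction r) simp_all

lemma sample_list_map: "sample_list A (map f Ds) = sample_list (\<lambda>D. A (f D)) Ds"
  by (induction Ds) simp_all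

lemma length_sample_list: "xs \<in> set_pmf (sample_list A Ds) \<Longrightarrow> length xs = length Ds"
  by (induction Ds arbitrary: xs) auto

definition pair_queries :: "nat \<Rightarrow> ('d \<times> 'd) list \<Rightarrow> 'd list" where
  "pair_queries r ps = concat (map (\<lambda>(D, D'). replicate r D @ replicate r D') ps)"

lemma length_pair_queries: "length (pair_queries r ps) = 2 * length ps * r"
  by (induction ps) (auto simp: pair_queries_def algebra_simps)

primrec regroup :: "nat \<Rightarrow> nat \<Rightarrow> 'a list \<Rightarrow> ('a list \<times> 'a list) list" where
  "regroup r 0 xs = []"
| "regroup r (Suc m) xs = (take r xs, take r (drop r xs)) # regroup r m (drop (2 * r) xs)"

text \<open>Flat lists of answers can be compared with transcripts and treated query by query;
  regrouping is deterministic post-processing.\<close>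

lemma sample_pairs_eq_sample_list:
  "sample_pairs r A ps = map_pmf (regroup r (length ps)) (sample_list A (pair_queries r ps))"
proof (induction ps)
  case (Cons p ps)
  obtain D D' where p: "p = (D, D')" by (cases p)
  have "map_pmf (regroup r (length (p # ps))) (sample_list A (pair_queries r (p # ps))) =
    do {xs \<leftarrow> sample_list A (replicate r D); ys \<leftarrow> sample_list A (replicate r D');
        zs \<leftarrow> sample_list A (pair_queries r ps);
        return_pmf (regroup r (Suc (length ps)) (xs @ ys @ zs))}"
    by (simp add: p pair_queries_def sample_list_append map_bind_pmf bind_assoc_pmf bind_return_pmf)
  also have "\<dots> =
    do {xs \<leftarrow> sample_list A (replicate r D); ys \<leftarrow> sample_list A (replicate r D');
        zs \<leftarrow> sample_list A (pair_queries r ps);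
        return_pmf ((xs, ys) # regroup r (length ps) zs)}"
    by (intro bind_pmf_cong refl) (auto dest!: length_sample_list)
  also have "\<dots> = sample_pairs r A (p # ps)"
    by (simp add: p sample_list_replicate Cons.IH bind_map_pmf)
  finally show ?case by (rule sym)
qed (simp add: pair_queries_def)

text \<open>Meant for transcripts in which the databases False and True alternate: round j occupies
  the positions 2j and 2j + 1, and the bit selects one of them.\<close>

definition pick_answers :: "bool list \<Rightarrow> (bool \<times> nat) list \<Rightarrow> nat list" where
  "pick_answers bs h = map (\<lambda>j. snd (h ! (2 * j + of_bool (bs ! j)))) [0..<length bs]"

text \<open>The pairs drawn by the non-adaptive tester are not visible in the transcript of a two-database
  tester.  So the latter queries both databases for every answer that may be needed and draws the
  pairs only with its verdict, which costs a factor of two.\<close>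

definition simulation :: "(database \<Rightarrow> bool) \<Rightarrow> na_tester \<Rightarrow> bool tester" where
  "simulation c T =
     \<lparr>num_queries = 2 * na_queries T,
      next_query = (\<lambda>h. return_pmf (odd (length h))),
      verdict = (\<lambda>h. do {ps \<leftarrow> choose_pairs T;
        na_verdict T ps (regroup (reps T) (length ps)
          (pick_answers (map c (pair_queries (reps T) ps)) h))})\<rparr>"

lemma length_transcript: "h \<in> set_pmf (transcript T A q) \<Longrightarrow> length h = q"
  by (induction q arbitrary: h) auto

lemma pick_answers_snoc:
  assumes "length h = 2 * length bs"
  shows "pick_answers (bs @ [b]) (h @ [(False, x), (True, y)]) =
    pick_answers bs h @ [if b then y else x]"
  using assms by (auto simp: pick_answers_def nth_append)

lemma transcript_simulation:
  "map_pmf (pick_answers bs) (transcript (simulation c T) B (2 * length bs)) = sample_list B bs"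
proof (induction bs rule: rev_induct)
  case Nil
  then show ?case by (simp add: pick_answers_def)
next
  case (snoc b bs)
  let ?tr = "transcript (simulation c T) B"
  have "map_pmf (pick_answers (bs @ [b])) (?tr (2 * length (bs @ [b]))) =
    do {h \<leftarrow> ?tr (2 * length bs); x \<leftarrow> B False; y \<leftarrow> B True;
        return_pmf (pick_answers (bs @ [b]) (h @ [(False, x), (True, y)]))}"
    by (auto simp: simulation_def map_bind_pmf bind_assoc_pmf bind_return_pmf
        dest!: length_transcript intro!: bind_pmf_cong)
  also have "\<dots> = do {h \<leftarrow> ?tr (2 * length bs); x \<leftarrow> B False; y \<leftarrow> B True;
        return_pmf (pick_answers bs h @ [if b then y else x])}"
    by (intro bind_pmf_cong refl) (auto dest!: length_transcript simp: pick_answers_snoc)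
  \<comment> \<open>The answer that is not picked is independent of the rest and integrates
    out.\<close>
  also have "\<dots> = do {h \<leftarrow> ?tr (2 * length bs); x \<leftarrow> B b; return_pmf (pick_answers bs h @ [x])}"
    by (cases b) simp_all
  also have "\<dots> = do {xs \<leftarrow> sample_list B bs; x \<leftarrow> B b; return_pmf (xs @ [x])}"
    unfolding snoc.IH[symmetric] bind_map_pmf ..
  also have "\<dots> = sample_list B (bs @ [b])"
    by (simp add: sample_list_append bind_assoc_pmf bind_return_pmf)
  finally show ?case .
qed

lemma run_simulation:
  assumes "well_formed \<Omega> T"
  shows "run_tester (simulation c T) B = run_na_tester T (\<lambda>D. B (c D))"
proof -
  let ?S = "simulation c T"
  let ?tr = "transcript ?S B (2 * na_queries T)"
  let ?bs = "\<lambda>ps. map c (pair_queries (reps T) ps)"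
  have "run_tester ?S B = do {h \<leftarrow> ?tr; ps \<leftarrow> choose_pairs T;
    na_verdict T ps (regroup (reps T) (length ps) (pick_answers (?bs ps) h))}"
    by (simp add: run_tester_def simulation_def)
  \<comment> \<open>Non-adaptivity enters here: the pairs are drawn independently of the answers, so
    they may be drawn before or after them.\<close>
  also have "\<dots> = do {ps \<leftarrow> choose_pairs T; h \<leftarrow> ?tr;
    na_verdict T ps (regroup (reps T) (length ps) (pick_answers (?bs ps) h))}"
    by (rule bind_commute_pmf)
  also have "\<dots> = do {ps \<leftarrow> choose_pairs T; ans \<leftarrow> sample_pairs (reps T) (\<lambda>D. B (c D)) ps;
    na_verdict T ps ans}"
  proof (intro bind_pmf_cong refl)
    fix ps assume "ps \<in> set_pmf (choose_pairs T)"
    \<comment> \<open>By well-formedness all draws need the same number of answers, so one fixed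
      budget serves them all.\<close>
    then have "2 * na_queries T = 2 * length (?bs ps)"
      using assms by (auto simp: well_formed_def length_pair_queries na_queries_def)
    then have "map_pmf (pick_answers (?bs ps)) ?tr =
      sample_list (\<lambda>D. B (c D)) (pair_queries (reps T) ps)"
      by (simp only: transcript_simulation sample_list_map)
    then have "do {xs \<leftarrow> map_pmf (pick_answers (?bs ps)) ?tr;
        na_verdict T ps (regroup (reps T) (length ps) xs)} =
      do {ans \<leftarrow> sample_pairs (reps T) (\<lambda>D. B (c D)) ps; na_verdict T ps ans}"
      by (simp only: sample_pairs_eq_sample_list bind_map_pmf)
    then show "do {h \<leftarrow> ?tr;
        na_verdict T ps (regroup (reps T) (length ps) (pick_answers (?bs ps) h))} =
      do {ans \<leftarrow> sample_pairs (reps T) (\<lambda>D. B (c D)) ps; na_verdict T ps ans}"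
      by (simp only: bind_map_pmf)
  qed
  finally show ?thesis by (simp add: run_na_tester_def)
qed

section \<open>Detecting a recolouring with few queries\<close>

lemma sample_list_cong:
  "(\<And>D. D \<in> set Ds \<Longrightarrow> A D = A' D) \<Longrightarrow> sample_list A Ds = sample_list A' Ds"
  by (induction Ds) simp_all

text \<open>Conditioned on pairs that avoid every database where A and A' differ, the answers have
  the same law under both, and so has the verdict. All other draws contribute at most their
  probability.\<close>

lemma na_acceptance_gap:
  "pmf (run_na_tester T A) True - pmf (run_na_tester T A') True \<le>
     measure_pmf.prob (choose_pairs T) {ps. \<exists>D\<in>set (pair_queries (reps T) ps). A D \<noteq> A' D}"
    (is "_ \<le> measure_pmf.prob ?P ?H")
proof -
  define F where "F A ps = pmf (sample_pairs (reps T) A ps \<bind> na_verdict T ps) True" for A ps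
  have int: "integrable (measure_pmf ?P) (F A)" for A
    by (rule measure_pmf.integrable_const_bound[where B = 1]) (auto simp: F_def pmf_le_1)
  have run: "pmf (run_na_tester T A) True = measure_pmf.expectation ?P (F A)" for A
    unfolding run_na_tester_def pmf_bind[of "choose_pairs T"] F_def ..
  have "F A ps - F A' ps \<le> indicator ?H ps" for ps
  proof (cases "ps \<in> ?H")
    case True
    have "F A ps \<le> 1" "0 \<le> F A' ps" by (simp_all add: F_def pmf_le_1)
    then show ?thesis using True by simp
  next
    case False
    then have "sample_list A (pair_queries (reps T) ps) = sample_list A' (pair_queries (reps T) ps)"
      by (intro sample_list_cong) auto
    then show ?thesis using False by (simp add: F_def sample_pairs_eq_sample_list)
  qed
  moreover have "integrable (measure_pmf ?P) (indicator ?H :: _ \<Rightarrow> real)"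
    by (rule measure_pmf.integrable_const_bound[where B = 1]) auto
  ultimately have "measure_pmf.expectation ?P (\<lambda>ps. F A ps - F A' ps) \<le>
    measure_pmf.expectation ?P (indicator ?H)"
    by (intro integral_mono Bochner_Integration.integrable_diff int) auto
  then show ?thesis
    by (simp add: run Bochner_Integration.integral_diff[OF int int])
qed

text \<open>For fixed pairs, the indicators add up to the number of values in I that g takes on the
  queried databases, which is at most the number of queries. Taking expectations gives the
  claim.\<close>

lemma sum_hit_prob_le_queries:
  assumes "well_formed \<Omega> T" "finite I"
  shows "(\<Sum>i\<in>I. measure_pmf.prob (choose_pairs T)
      {ps. \<exists>D\<in>set (pair_queries (reps T) ps). g D = i}) \<le> na_queries T"
proof -
  let ?P = "choose_pairs T"
  define H where "H i = {ps. \<exists>D\<in>set (pair_queries (reps T) ps). g D = i}" for i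
  have "(\<Sum>i\<in>I. indicator (H i) ps :: real) \<le> na_queries T" if "ps \<in> set_pmf ?P" for ps
  proof -
    let ?Ds = "pair_queries (reps T) ps"
    have "(\<Sum>i\<in>I. indicator (H i) ps :: real) = (\<Sum>i\<in>I. indicator (g ` set ?Ds) i)"
      by (intro sum.cong refl) (auto simp: H_def indicator_def)
    also have "\<dots> = card (I \<inter> g ` set ?Ds)"
      using assms(2) by (simp add: indicator_def sum.If_cases)
    also have "card (I \<inter> g ` set ?Ds) \<le> length ?Ds"
      by (meson List.finite_set card_image_le card_length card_mono finite_imageI inf_le2 le_trans)
    also have "length ?Ds = na_queries T"
      using assms(1) that by (auto simp: well_formed_def length_pair_queries na_queries_def)
    finally show ?thesis by simp
  qed
  moreover have int: "integrable (measure_pmf ?P) (indicator (H i) :: _ \<Rightarrow> real)" for i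
    by (rule measure_pmf.integrable_const_bound[where B = 1]) auto
  ultimately have "measure_pmf.expectation ?P (\<lambda>ps. \<Sum>i\<in>I. indicator (H i) ps :: real) \<le>
    measure_pmf.expectation ?P (\<lambda>_. na_queries T)"
    by (intro integral_mono_AE Bochner_Integration.integrable_sum)
      (simp_all add: AE_measure_pmf_iff)
  then show ?thesis
    by (simp add: Bochner_Integration.integral_sum[OF int] flip: H_def)
qed

section \<open>The two lower bounds\<close>

lemma algorithms_colouring:
  "B \<in> algorithms n UNIV \<Longrightarrow> (\<lambda>D. B (c D)) \<in> algorithms n X"
  by (auto simp: algorithms_def)

lemma point_dist_data_model: "0 < M \<Longrightarrow> ({..<2 * M}, point_dist M p) \<in> data_models"
  using set_point_dist by (auto simp: data_models_def lessThan_empty_iff)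

lemma ex_far_of_lower_bound:
  assumes "two_database_lower_bound n \<Xi> \<alpha> r" "0 < r"
  obtains B where "B \<in> algorithms n UNIV" "far_from_private two_nbrs \<Xi> \<alpha> B"
proof -
  define T :: "bool tester" where
    "T = \<lparr>num_queries = 0, next_query = (\<lambda>_. return_pmf True), verdict = (\<lambda>_. return_pmf True)\<rparr>"
  have "run_tester T B = return_pmf True" for B
    by (simp add: run_tester_def T_def bind_return_pmf)
  moreover have "\<not> two_database_tester n \<Xi> \<alpha> T"
    using assms by (auto simp: two_database_lower_bound_def T_def)
  ultimately show thesis
    using that by (auto simp: two_database_tester_def tests_property_def)
qed

lemma two_database_bound_transfers:
  assumes T: "random_privacy_tester n k lam \<Xi> \<gamma> \<alpha> T"
    and lb: "two_database_lower_bound n \<Xi> \<alpha> r"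
    and "1 \<le> k" "valid_param \<Xi>" "0 < \<gamma>" "0 < lam" "\<gamma> + \<alpha> / lam < 1 / 2"
  shows "ereal (r / 2) \<le> query_complexity T"
proof -
  \<comment> \<open>With M = 1 the only residue is 0, so a data point is just a fair bit, and the
    parity colouring has bichromatic probability 1/2.\<close>
  define M :: "nat set \<times> nat pmf" where "M = ({..<2 * 1}, point_dist 1 (1 / 2))"
  define c where "c = colour 1 {}"
  have M: "M \<in> data_models"
    unfolding M_def by (rule point_dist_data_model) simp
  then have wf: "well_formed {..<2 * 1} (T M)"
    and tests: "tests_property (algorithms n (databases {..<2 * 1}))
      (random_private k (point_dist 1 (1 / 2)) \<Xi> \<gamma>)
      (far_from_random_private k (point_dist 1 (1 / 2)) lam \<Xi> \<gamma> \<alpha>) (run_na_tester (T M))"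
    using T by (auto simp: random_privacy_tester_def M_def)
  have v: "violation k (point_dist 1 (1 / 2)) c = 1 / 2"
    using \<open>1 \<le> k\<close> unfolding c_def by (subst violation_colour) (auto simp: xor_prob_def)
  have "two_database_tester n \<Xi> \<alpha> (simulation c (T M))"
    unfolding two_database_tester_def tests_property_def run_simulation[OF wf]
  proof (intro ballI)
    fix B :: "bool algorithm" assume B: "B \<in> algorithms n UNIV"
    have "dp_private two_nbrs \<Xi> B \<Longrightarrow>
        random_private k (point_dist 1 (1 / 2)) \<Xi> \<gamma> (\<lambda>D. B (c D))"
      using assms by (intro random_private_colouring) auto
    moreover have "far_from_private two_nbrs \<Xi> \<alpha> B \<Longrightarrow>
        far_from_random_private k (point_dist 1 (1 / 2)) lam \<Xi> \<gamma> \<alpha> (\<lambda>D. B (c D))"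
      by (rule far_from_random_private_colouring) (use assms(6,7) in \<open>simp_all only: v\<close>)
    ultimately show "(dp_private two_nbrs \<Xi> B \<longrightarrow>
        2 / 3 \<le> pmf (run_na_tester (T M) (\<lambda>D. B (c D))) True) \<and>
      (far_from_private two_nbrs \<Xi> \<alpha> B \<longrightarrow>
        2 / 3 \<le> pmf (run_na_tester (T M) (\<lambda>D. B (c D))) False)"
      using tests algorithms_colouring[OF B] unfolding tests_property_def by blast
  qed
  then have "r \<le> real (num_queries (simulation c (T M)))"
    using lb by (simp add: two_database_lower_bound_def)
  \<comment> \<open>The factor 1/2 is the cost of querying both databases in the simulation.\<close>
  then have "ereal (r / 2) \<le> ereal (real (na_queries (T M)))"
    by (simp add: simulation_def)
  also have "\<dots> \<le> query_complexity T"
    unfolding query_complexity_def using M by (rule SUP_upper)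
  finally show ?thesis .
qed

lemma hidden_residue_bound:
  assumes T: "random_privacy_tester n k lam \<Xi> \<gamma> \<alpha> T"
    and B: "B \<in> algorithms n UNIV" "far_from_private two_nbrs \<Xi> \<alpha> B"
    and "1 \<le> k" "valid_param \<Xi>" "0 < \<gamma>" "0 < \<alpha>" "0 < lam" "\<gamma> + \<alpha> / lam \<le> 1 / 8"
  shows "ereal (lam / (4 * \<alpha>)) \<le> query_complexity T"
proof -
  define \<eta> where "\<eta> = \<alpha> / lam"
  have \<eta>: "0 < \<eta>" "\<eta> \<le> 1 / 8" "\<gamma> \<le> 1 / 8" "\<gamma> + \<eta> \<le> 1 / 8"
  proof -
    show "0 < \<eta>" "\<gamma> + \<eta> \<le> 1 / 8" using assms by (simp_all only: \<eta>_def divide_pos_pos)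
    then show "\<eta> \<le> 1 / 8" "\<gamma> \<le> 1 / 8" using \<open>0 < \<gamma>\<close> by linarith+
  qed
  \<comment> \<open>The largest M for which a single residue still has probability \<mu> = 1/M at
    least \<eta>.\<close>
  define M where "M = nat \<lfloor>1 / \<eta>\<rfloor>"
  have inv: "8 \<le> 1 / \<eta>" using \<eta> by (simp add: field_simps)
  then have "8 \<le> \<lfloor>1 / \<eta>\<rfloor>" by linarith
  then have M: "8 \<le> M" "real M \<le> 1 / \<eta>" "1 / \<eta> - 1 < real M"
    using inv by (auto simp: M_def) linarith+
  define \<mu> where "\<mu> = 1 / real M"
  have \<mu>: "\<eta> \<le> \<mu>" "0 < \<mu>" "\<mu> \<le> 1 / 8"
    using M \<eta> by (auto simp: \<mu>_def field_simps)
  define s where "s = sqrt (1 - 2 * \<gamma>)"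
  define p where "p = (1 - s) / 2"
  have "s ^ 2 = 1 - 2 * \<gamma>" using \<eta> by (simp add: s_def)
  then have p\<gamma>: "2 * p * (1 - p) = \<gamma>"
    by (simp add: p_def power2_eq_square field_simps)
  have p: "0 \<le> p" "p \<le> 1"
  proof -
    have "0 \<le> s" "s \<le> 1" using \<eta> \<open>0 < \<gamma>\<close> by (simp_all add: s_def)
    then show "0 \<le> p" "p \<le> 1" by (simp_all add: p_def)
  qed
  define \<D> where "\<D> = point_dist M p"
  define base where "base = (\<lambda>D. B (colour M {} D))"
  define modified where "modified i = (\<lambda>D. B (colour M {i} D))" for i
  define g where "g D = weighted_sum (2 * M) (\<lambda>x. int (x div 2)) D mod int M" for D
  have model: "({..<2 * M}, \<D>) \<in> data_models"
    using M unfolding \<D>_def by (intro point_dist_data_model) auto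
  define U where "U = T ({..<2 * M}, \<D>)"
  have wf: "well_formed {..<2 * M} U"
    and tests: "tests_property (algorithms n (databases {..<2 * M}))
      (random_private k \<D> \<Xi> \<gamma>) (far_from_random_private k \<D> lam \<Xi> \<gamma> \<alpha>) (run_na_tester U)"
    using T model by (auto simp: random_privacy_tester_def U_def)
  have "violation k \<D> (colour M {}) = \<gamma>"
    using M p \<open>1 \<le> k\<close> p\<gamma> unfolding \<D>_def
    by (subst violation_colour) (auto simp: xor_prob_def algebra_simps)
  then have "random_private k \<D> \<Xi> \<gamma> base"
    using assms unfolding base_def by (intro random_private_colouring) auto
  then have accept: "2 / 3 \<le> pmf (run_na_tester U base) True"
    using tests algorithms_colouring[OF B(1)] unfolding tests_property_def base_def by blast
  have gap: "1 / 3 \<le> measure_pmf.prob (choose_pairs U)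
      {ps. \<exists>D\<in>set (pair_queries (reps U) ps). g D = i}" if i: "i \<in> {0..<int M}" for i
  proof -
    have "violation k \<D> (colour M {i}) = xor_prob (xor_prob p \<mu>) (xor_prob p \<mu>)"
      using M p \<open>1 \<le> k\<close> i unfolding \<D>_def by (subst violation_colour) (auto simp: \<mu>_def)
    \<comment> \<open>Four independent bits are combined, two of bias p and two of bias \<mu>.
      Regrouping them by bias gives the form a + b(1 - 2a) with a = 2p(1 - p) and b = 2\<mu>(1 -
      \<mu>).\<close>
    also have "\<dots> = 2 * p * (1 - p) + 2 * \<mu> * (1 - \<mu>) * (1 - 2 * (2 * p * (1 - p)))"
      by (simp add: xor_prob_def algebra_simps)
    also have "\<dots> = \<gamma> + 2 * \<mu> * (1 - \<mu>) * (1 - 2 * \<gamma>)" by (simp only: p\<gamma>)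
    also have "\<dots> > \<gamma> + \<eta>"
    proof -
      \<comment> \<open>As \<mu> and \<gamma> are at most 1/8, the increase is at least 21/16 times
        \<mu>, hence strictly above \<eta>.\<close>
      have "2 * \<mu> * (7 / 8) * (3 / 4) \<le> 2 * \<mu> * (1 - \<mu>) * (1 - 2 * \<gamma>)"
        using \<mu> \<eta> by (intro mult_mono) auto
      then show ?thesis using \<mu> by linarith
    qed
    finally have "far_from_random_private k \<D> lam \<Xi> \<gamma> \<alpha> (modified i)"
      using assms unfolding modified_def \<eta>_def
      by (intro far_from_random_private_colouring) auto
    then have "2 / 3 \<le> pmf (run_na_tester U (modified i)) False"
      using tests algorithms_colouring[OF B(1)] unfolding tests_property_def modified_def by blast
    \<comment> \<open>The base algorithm is accepted with probability at least 2/3, the modified one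
      with probability at most 1/3.\<close>
    then have "1 / 3 \<le> pmf (run_na_tester U base) True - pmf (run_na_tester U (modified i)) True"
      using accept by (simp add: pmf_False_conv_True)
    also have "\<dots> \<le> measure_pmf.prob (choose_pairs U)
        {ps. \<exists>D\<in>set (pair_queries (reps U) ps). base D \<noteq> modified i D}"
      by (rule na_acceptance_gap)
    also have "\<dots> \<le> measure_pmf.prob (choose_pairs U)
        {ps. \<exists>D\<in>set (pair_queries (reps U) ps). g D = i}"
    proof (rule measure_pmf.finite_measure_mono)
      have "g D = i" if "base D \<noteq> modified i D" for D
        using that by (cases "g D = i") (simp_all add: base_def modified_def colour_def g_def)
      then show "{ps. \<exists>D\<in>set (pair_queries (reps U) ps). base D \<noteq> modified i D} \<subseteq>
          {ps. \<exists>D\<in>set (pair_queries (reps U) ps). g D = i}"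
        by blast
    qed simp
    finally show ?thesis .
  qed
  have "real M / 3 = (\<Sum>i\<in>{0..<int M}. 1 / 3)" by simp
  also have "\<dots> \<le> (\<Sum>i\<in>{0..<int M}. measure_pmf.prob (choose_pairs U)
      {ps. \<exists>D\<in>set (pair_queries (reps U) ps). g D = i})"
    using gap by (rule sum_mono)
  also have "\<dots> \<le> na_queries U"
    using wf by (rule sum_hit_prob_le_queries) simp
  finally have "real M / 3 \<le> na_queries U" .
  moreover have "lam / (4 * \<alpha>) = 1 / \<eta> / 4" by (simp add: \<eta>_def)
  \<comment> \<open>M/3 exceeds (1/\<eta> - 1)/3, which is at least 1/(4\<eta>) because 1/\<eta>
    \<ge> 8.\<close>
  ultimately have "ereal (lam / (4 * \<alpha>)) \<le> ereal (real (na_queries U))"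
    using M inv by simp
  also have "\<dots> \<le> query_complexity T"
    unfolding query_complexity_def U_def using model by (rule SUP_upper)
  finally show ?thesis .
qed

theorem theorem8:
  shows "\<exists>c>(0::real). \<exists>\<tau>>(0::real).
     \<forall>(n::nat) (k::nat) (\<Xi>::privacy_param) (\<gamma>::real) (\<alpha>::real) (lam::real) (r::real) (T::na_tester_family).
     k \<ge> 1 \<longrightarrow> valid_param \<Xi> \<longrightarrow> \<gamma> > 0 \<longrightarrow> \<alpha> > 0 \<longrightarrow> lam > 0 \<longrightarrow>
     r > 0 \<longrightarrow> two_database_lower_bound n \<Xi> \<alpha> r \<longrightarrow>
     \<gamma> + \<alpha> / lam \<le> \<tau> \<longrightarrow>
     random_privacy_tester n k lam \<Xi> \<gamma> \<alpha> T \<longrightarrow>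
     ereal (c * max r (lam / \<alpha>)) \<le> query_complexity T"
proof (rule exI[of _ "1 / 4"], intro conjI, simp, rule exI[of _ "1 / 8"], intro conjI, simp,
    intro allI impI)
  fix n k :: nat and \<Xi> :: privacy_param and \<gamma> \<alpha> lam r :: real and T :: na_tester_family
  assume asm: "1 \<le> k" "valid_param \<Xi>" "0 < \<gamma>" "0 < \<alpha>" "0 < lam" "0 < r"
    "two_database_lower_bound n \<Xi> \<alpha> r" "\<gamma> + \<alpha> / lam \<le> 1 / 8"
    "random_privacy_tester n k lam \<Xi> \<gamma> \<alpha> T"
  obtain B where "B \<in> algorithms n UNIV" "far_from_private two_nbrs \<Xi> \<alpha> B"
    using ex_far_of_lower_bound asm by blast
  then have "ereal (lam / (4 * \<alpha>)) \<le> query_complexity T"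
    using asm hidden_residue_bound by blast
  moreover have "ereal (r / 2) \<le> query_complexity T"
    by (rule two_database_bound_transfers[OF asm(9,7,1-3,5)]) (use asm(8) in linarith)
  \<comment> \<open>The two bounds lose the factors 2 and 4, so the constant 1/4 serves
    both.\<close>
  moreover have "1 / 4 * max r (lam / \<alpha>) \<le> max (r / 2) (lam / (4 * \<alpha>))"
    using asm by (auto simp: max_def)
  ultimately show "ereal (1 / 4 * max r (lam / \<alpha>)) \<le> query_complexity T"
    by (metis ereal_less_eq(3) max_def order_trans)
qed

end
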